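(* If $\Theta$ is a compact Hausdorff space, $\Lambda\subseteq\mathbb{R}_+^m$ is compact, and the objective and constraint functions $g_0,g_1,\dots,g_m:\Theta\to\mathbb{R}$ are continuous, then the Lagrangian game, in which the $\theta$-player minimizes and the $\lambda$-player maximizes $\mathcal{L}(\theta,\lambda):=g_0(\theta)+\sum_{i=1}^m\lambda_ig_i(\theta)$ over $\Theta\times\Lambda$, has a mixed Nash equilibrium pair $(\theta,\lambda)$ where $\theta$ is a random variable supported on at most $m+1$ elements of $\Theta$, and $\lambda$ is non-random.
   Context: A pair consisting of a $\Theta$-valued random variable $\theta$ and a non-random $\lambda\in\Lambda$ is a mixed Nash equilibrium of the Lagrangian game if $$\mathbb{E}_\theta[\mathcal{L}(\theta,\lambda)]=\min_{\theta^*\in\Theta}\mathcal{L}(\theta^*,\lambda)\quad\text{and}\quad\mathbb{E}_\theta[\mathcal{L}(\theta,\lambda)]=\max_{\lambda^*\in\Lambda}\mathbb{E}_\theta[\mathcal{L}(\theta,\lambda^* )].$$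
   Formalization: Λ is additionally assumed convex, and Θ and Λ nonempty; for merely compact Λ the claim fails, e.g. Θ={a,b}, Λ={0,1}, g_0=(0,1), g_1=(1,-1) (matching pennies) has no equilibrium with non-random λ. *)

theory Defs
  imports "HOL-Probability.Probability_Measure"
begin

definition lagrangian ::
  "('a \<Rightarrow> real) \<Rightarrow> ('m::finite \<Rightarrow> 'a \<Rightarrow> real) \<Rightarrow> 'a \<Rightarrow> real ^ 'm \<Rightarrow> real"
  where "lagrangian g0 g \<theta> l = g0 \<theta> + (\<Sum>i\<in>UNIV. l $ i * g i \<theta>)"

definition is_min_value :: "('b \<Rightarrow> real) \<Rightarrow> 'b set \<Rightarrow> real \<Rightarrow> bool"
  where "is_min_value f A v \<longleftrightarrow> v \<in> f ` A \<and> (\<forall>x\<in>A. v \<le> f x)"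

definition is_max_value :: "('b \<Rightarrow> real) \<Rightarrow> 'b set \<Rightarrow> real \<Rightarrow> bool"
  where "is_max_value f A v \<longleftrightarrow> v \<in> f ` A \<and> (\<forall>x\<in>A. f x \<le> v)"

text \<open>The library's \<open>borel\<close> belongs to the type-class topology; this is the Borel
  \<open>\<sigma>\<close>-algebra of an explicit topology.\<close>

definition borel_on :: "'a topology \<Rightarrow> 'a measure"
  where "borel_on X = sigma (topspace X) {U. openin X U}"

text \<open>The random strategy is a measurable map \<open>\<theta>\<close> from a probability space \<open>M\<close> into the space
  \<open>X\<close> (that is, \<open>\<Theta>\<close>) with its Borel sets. If \<open>X\<close> is compact and \<open>g0\<close>, \<open>g i\<close> are
  continuous, every integrand below is bounded and measurable, so the Bochner integrals are
  genuine expectations.\<close>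

definition mixed_nash_equilibrium ::
  "'a topology \<Rightarrow> (real ^ 'm) set \<Rightarrow> ('a \<Rightarrow> real) \<Rightarrow> ('m::finite \<Rightarrow> 'a \<Rightarrow> real) \<Rightarrow>
    'w measure \<Rightarrow> ('w \<Rightarrow> 'a) \<Rightarrow> real ^ 'm \<Rightarrow> bool"
  where "mixed_nash_equilibrium X \<Lambda> g0 g M \<theta> l \<longleftrightarrow>
    prob_space M \<and> \<theta> \<in> measurable M (borel_on X) \<and> l \<in> \<Lambda> \<and>
    is_min_value (\<lambda>t. lagrangian g0 g t l) (topspace X)
      (\<integral>\<omega>. lagrangian g0 g (\<theta> \<omega>) l \<partial>M) \<and>
    is_max_value (\<lambda>l'. \<integral>\<omega>. lagrangian g0 g (\<theta> \<omega>) l' \<partial>M) \<Lambda>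
      (\<integral>\<omega>. lagrangian g0 g (\<theta> \<omega>) l \<partial>M)"

definition supported_on_at_most ::
  "'a topology \<Rightarrow> 'w measure \<Rightarrow> ('w \<Rightarrow> 'a) \<Rightarrow> nat \<Rightarrow> bool"
  where "supported_on_at_most X M \<theta> n \<longleftrightarrow>
    (\<exists>S \<subseteq> topspace X. finite S \<and> card S \<le> n \<and> (AE \<omega> in M. \<theta> \<omega> \<in> S))"

end

(* With G = (g0, g) the Lagrangian is the inner product of (1, l) and G t, so randomising over
   Theta amounts to choosing z in K, the convex hull of the compact set G(Theta). The game on
   K x Lambda is bilinear, and a saddle point (z, l) of it solves the variational inequality of
   the vector field (minimiser's gradient, minus maximiser's gradient); it exists by Brouwer's
   theorem. Since z minimises the functional (1, l) over K, it lies on a face of K contained in a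
   hyperplane of the (m+1)-dimensional space. Caratheodory's theorem inside that hyperplane
   represents z by m+1 points of G(Theta) rather than m+2. *)
theory Submission
  imports Defs
begin

text \<open>The fixed points of \<open>x \<mapsto> closest_point S (x - F x)\<close> are the solutions.\<close>

lemma variational_inequality:
  fixes F :: "'a::euclidean_space \<Rightarrow> 'a"
  assumes S: "compact S" "convex S" "S \<noteq> {}" and F: "continuous_on S F"
  obtains x where "x \<in> S" "\<And>y. y \<in> S \<Longrightarrow> 0 \<le> F x \<bullet> (y - x)"
proof -
  define P where "P x = closest_point S (x - F x)" for x
  have closed: "closed S"
    using S by (simp add: compact_imp_closed)
  have "continuous_on S P"
    unfolding P_def
    by (rule continuous_on_compose2[OF continuous_on_closest_point[of S UNIV]])
       (use S closed F in \<open>auto intro!: continuous_intros\<close>)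
  moreover have "P \<in> S \<rightarrow> S"
    using closest_point_in_set[OF closed S(3)] by (simp add: P_def)
  ultimately obtain x where x: "x \<in> S" "P x = x"
    using brouwer[OF S] by blast
  have "0 \<le> F x \<bullet> (y - x)" if "y \<in> S" for y
  proof -
    \<comment> \<open>Obtuse angle at the projection; since \<open>P x = x\<close>, the first factor
      is \<open>- F x\<close>.\<close>
    have "(x - F x - P x) \<bullet> (y - P x) \<le> 0"
      unfolding P_def by (rule closest_point_dot[OF S(2) closed that])
    then show ?thesis
      by (simp add: x)
  qed
  with x(1) show thesis
    using that by blast
qed

lemma affine_bilinear_saddle_point:
  fixes K :: "(real \<times> 'b::euclidean_space) set" and L :: "'b set"
  assumes K: "compact K" "convex K" "K \<noteq> {}" and L: "compact L" "convex L" "L \<noteq> {}"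
  obtains z l where "z \<in> K" "l \<in> L"
    "\<And>z'. z' \<in> K \<Longrightarrow> (1, l) \<bullet> z \<le> (1, l) \<bullet> z'"
    "\<And>l'. l' \<in> L \<Longrightarrow> (1, l') \<bullet> z \<le> (1, l) \<bullet> z"
proof -
  define F :: "(real \<times> 'b) \<times> 'b \<Rightarrow> (real \<times> 'b) \<times> 'b"
    where "F w = ((1, snd w), - snd (fst w))" for w
  have "compact (K \<times> L)" "convex (K \<times> L)" "K \<times> L \<noteq> {}"
    using K L by (auto intro: compact_Times convex_Times)
  moreover have "continuous_on (K \<times> L) F"
    unfolding F_def by (intro continuous_intros)
  ultimately obtain w where w: "w \<in> K \<times> L" "\<And>y. y \<in> K \<times> L \<Longrightarrow> 0 \<le> F w \<bullet> (y - w)"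
    by (rule variational_inequality) blast
  obtain z l where wz: "w = (z, l)"
    by (cases w)
  show thesis
  proof
    show "z \<in> K" "l \<in> L"
      using w(1) wz by auto
    \<comment> \<open>Moving one component of \<open>w\<close> at a time splits the variational
      inequality into the two saddle inequalities.\<close>
    show "(1, l) \<bullet> z \<le> (1, l) \<bullet> z'" if "z' \<in> K" for z'
      using w(2)[of "(z', l)"] that \<open>l \<in> L\<close> by (simp add: F_def wz inner_diff_right)
    show "(1, l') \<bullet> z \<le> (1, l) \<bullet> z" if "l' \<in> L" for l'
      using w(2)[of "(z, l')"] that \<open>z \<in> K\<close>
      by (cases z) (simp add: F_def wz inner_diff_right inner_commute)
  qed
qed

lemma caratheodory_supporting_hyperplane:
  fixes P :: "'a::euclidean_space set"
  assumes "compact P" "a \<noteq> 0" "z \<in> convex hull P" and min: "\<And>y. y \<in> P \<Longrightarrow> a \<bullet> z \<le> a \<bullet> y"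
  obtains S u where "finite S" "S \<subseteq> P" "card S \<le> DIM('a)" "\<forall>v\<in>S. 0 \<le> u v"
    "sum u S = 1" "(\<Sum>v\<in>S. u v *\<^sub>R v) = z"
proof -
  let ?H = "{x. a \<bullet> x = a \<bullet> z}"
  have "convex hull P \<subseteq> {x. a \<bullet> z \<le> a \<bullet> x}"
    using min by (intro hull_minimal) (auto simp: convex_halfspace_ge)
  then have "(convex hull P \<inter> ?H) face_of (convex hull P)"
    by (intro face_of_Int_supporting_hyperplane_ge) auto
  \<comment> \<open>A face of the hull of a compact set is the hull of some of its points, so the
    representing points stay in \<open>P\<close>.\<close>
  then obtain P' where P': "P' \<subseteq> P" "convex hull P \<inter> ?H = convex hull P'"
    using face_of_convex_hull_subset[OF \<open>compact P\<close>] by metis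
  have "P' \<subseteq> ?H"
    using P'(2) hull_subset[of P' convex] by auto
  \<comment> \<open>As \<open>a \<noteq> 0\<close>, the hyperplane has dimension
    \<open>DIM('a) - 1\<close>, which absorbs the \<open>+ 1\<close> of Caratheodory's
    bound.\<close>
  then have dim: "aff_dim P' + 1 \<le> DIM('a)"
    using aff_dim_subset[of P' ?H] \<open>a \<noteq> 0\<close> by simp
  have "z \<in> convex hull P'"
    using assms(3) P'(2) by auto
  then obtain S u where "finite S" "S \<subseteq> P'" "card S \<le> aff_dim P' + 1" "\<forall>v\<in>S. 0 \<le> u v"
    "sum u S = 1" "(\<Sum>v\<in>S. u v *\<^sub>R v) = z"
    unfolding convex_hull_caratheodory_aff_dim by auto
  with dim P'(1) show thesis
    by (intro that[of S u]) auto
qed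

lemma continuous_map_Pair_vec_lambda:
  assumes "continuous_map X euclidean f" "\<And>i. continuous_map X euclidean (g i)"
  shows "continuous_map X euclidean (\<lambda>x. (f x, \<chi> i. g i x))"
  using assms by (auto simp: continuous_map_atin intro!: tendsto_Pair tendsto_vec_lambda)

lemma lagrangian_eq_inner: "lagrangian g0 g t l = (1, l) \<bullet> (g0 t, \<chi> i. g i t)"
  by (simp add: lagrangian_def inner_vec_def)

(* Convexity of \<Lambda> is needed for a non-random strategy in \<Lambda>: with \<Theta> = {a, b}, m = 1, \<Lambda> = {0, 1},
   g0 a = 0, g1 a = 1, g0 b = 1, g1 b = -1 the game is matching pennies, which has no
   equilibrium with a deterministic strategy in \<Lambda>.
   The law of an arbitrary \<Theta>-valued random variable is realised with sample space \<Theta> itself,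
   so nothing is lost by letting M range over measures on the type 'a. *)
theorem lemma2:
  fixes X :: "'a topology" and \<Lambda> :: "(real ^ 'm::finite) set"
    and g0 :: "'a \<Rightarrow> real" and g :: "'m \<Rightarrow> 'a \<Rightarrow> real"
  assumes "compact_space X" and "Hausdorff_space X" and "topspace X \<noteq> {}"
    and "compact \<Lambda>" and "convex \<Lambda>" and "\<Lambda> \<noteq> {}"
    and "\<Lambda> \<subseteq> {l. \<forall>i. 0 \<le> l $ i}"
    and "continuous_map X euclideanreal g0"
    and "\<And>i. continuous_map X euclideanreal (g i)"
  shows "\<exists>(M :: 'a measure) (\<theta> :: 'a \<Rightarrow> 'a) l.
    mixed_nash_equilibrium X \<Lambda> g0 g M \<theta> l \<and>
    supported_on_at_most X M \<theta> (CARD('m) + 1)"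
proof -
  define G where "G t = (g0 t, \<chi> i. g i t)" for t
  let ?P = "G ` topspace X"
  have "compactin euclidean ?P"
    using assms(1) continuous_map_Pair_vec_lambda[OF assms(8,9)]
    unfolding G_def compact_space_def by (rule image_compactin)
  then have P: "compact ?P"
    by simp
  obtain z l where zP: "z \<in> convex hull ?P" and l: "l \<in> \<Lambda>"
    and zmin: "\<And>z'. z' \<in> convex hull ?P \<Longrightarrow> (1, l) \<bullet> z \<le> (1, l) \<bullet> z'"
    and lmax: "\<And>l'. l' \<in> \<Lambda> \<Longrightarrow> (1, l') \<bullet> z \<le> (1, l) \<bullet> z"
    using affine_bilinear_saddle_point[of "convex hull ?P" \<Lambda>] P assms(3-6)
    by (auto simp: compact_convex_hull)
  have nz: "(1 :: real, l) \<noteq> 0"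
    by (simp add: prod_eq_iff)
  have min: "(1, l) \<bullet> z \<le> (1, l) \<bullet> y" if "y \<in> ?P" for y
    using that by (intro zmin hull_inc)
  obtain S u where S: "finite S" "S \<subseteq> ?P" "card S \<le> DIM(real \<times> (real ^ 'm))"
    and u: "\<forall>v\<in>S. 0 \<le> u v" "sum u S = 1" and z: "(\<Sum>v\<in>S. u v *\<^sub>R v) = z"
    by (rule caratheodory_supporting_hyperplane[OF P nz zP min]) blast
  \<comment> \<open>One preimage per point of \<open>S\<close>: cardinality is kept and sums over
    \<open>S\<close> reindex to \<open>T\<close>.\<close>
  obtain T where T: "T \<subseteq> topspace X" "inj_on G T" "S = G ` T"
    using S(2) by (auto simp: subset_image_inj)
  have "finite T" and card: "card T \<le> CARD('m) + 1"
    using S T by (auto simp: card_image finite_image_iff)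
  \<comment> \<open>The support \<open>T\<close>, with all subsets measurable, serves as sample
    space; the random variable is \<open>id\<close>.\<close>
  define M where "M = point_measure T (u \<circ> G)"
  have uG: "0 \<le> (u \<circ> G) t" if "t \<in> T" for t
    using u(1) T(3) that by simp
  have "sum (u \<circ> G) T = 1"
    using u(2) T by (simp add: sum.reindex)
  then have "prob_space M"
    unfolding M_def using uG
    by (intro prob_space_point_measure \<open>finite T\<close>) auto
  \<comment> \<open>The payoff is linear in \<open>G t\<close>, so the expectation sees only the
    barycentre \<open>z\<close>.\<close>
  have E: "(\<integral>\<omega>. lagrangian g0 g (id \<omega>) l' \<partial>M) = (1, l') \<bullet> z" for l'
  proof -
    have "(\<integral>\<omega>. lagrangian g0 g (id \<omega>) l' \<partial>M) = (\<Sum>t\<in>T. u (G t) * ((1, l') \<bullet> G t))"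
      unfolding M_def
      by (subst lebesgue_integral_point_measure_finite[OF \<open>finite T\<close> uG])
         (simp_all add: lagrangian_eq_inner G_def)
    also have "\<dots> = (1, l') \<bullet> (\<Sum>t\<in>T. u (G t) *\<^sub>R G t)"
      by (simp add: inner_sum_right)
    also have "(\<Sum>t\<in>T. u (G t) *\<^sub>R G t) = z"
      using z T by (simp add: sum.reindex)
    finally show ?thesis .
  qed
  have le: "(1, l) \<bullet> z \<le> lagrangian g0 g t l" if "t \<in> topspace X" for t
    using min[of "G t"] that by (simp add: lagrangian_eq_inner G_def)
  \<comment> \<open>The minimum is attained: otherwise \<open>?P\<close>, and so its hull, would lie
    in an open half-space that misses \<open>z\<close>.\<close>
  have "\<exists>t\<in>topspace X. (1, l) \<bullet> z = lagrangian g0 g t l"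
  proof (rule ccontr)
    assume none: "\<not> ?thesis"
    have "?P \<subseteq> {y. (1, l) \<bullet> z < (1, l) \<bullet> y}"
      using le none by (fastforce simp: lagrangian_eq_inner G_def simp del: inner_Pair)
    then have "convex hull ?P \<subseteq> {y. (1, l) \<bullet> y > (1, l) \<bullet> z}"
      by (intro hull_minimal convex_halfspace_gt)
    with zP show False
      by auto
  qed
  then have "mixed_nash_equilibrium X \<Lambda> g0 g M id l"
    unfolding mixed_nash_equilibrium_def E is_min_value_def is_max_value_def
    using \<open>prob_space M\<close> l le lmax T(1)
    by (auto simp: M_def borel_on_def space_measure_of_conv image_iff)
  moreover have "supported_on_at_most X M id (CARD('m) + 1)"
    unfolding supported_on_at_most_def M_def AE_point_measure
    using T(1) \<open>finite T\<close> card by auto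
  ultimately show ?thesis
    by blast
qed

end
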